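(* Let $\alpha=-1/d$, where $d\ge2$ is an integer, and let $p=-\alpha=1/d$. Let $\mathcal{C}_n$ be the root cluster of $\mathcal{T}_n=\mathcal{T}_{-1/d,n}$ with broadcasting induced colouring with parameter $p$. Then for every integer $k\ge1$, as $n\to\infty$, $$\mathbb{E}[|\mathcal{C}_n|^k]\sim E_k\ln^{2k-1}n,$$ where $E_k$ satisfies the recursion $E_1=1/(d-1)$ and, for $k\ge2$, $$(2k-1)E_k=\frac{1}{2d}\sum_{j=1}^{k-1}\binom kjE_jE_{k-j}.$$
   Context: The random trees $(\mathcal{T}_n)_{n\ge1}=(\mathcal{T}_{-1/d,n})_{n\ge1}$ are rooted trees grown recursively: $\mathcal{T}_1$ is a single vertex $\rho$, the root of all the trees; $\mathcal{T}_n$ is obtained from $\mathcal{T}_{n-1}$ by choosing a vertex $v$ of $\mathcal{T}_{n-1}$ at random with probability $\frac{1-\deg^+(v)/d}{\sum_{u\in V(\mathcal{T}_{n-1})}(1-\deg^+(u)/d)}$ and adding a new child to $v$, where $\deg^+(u)$ is the number of children of $u$ in $\mathcal{T}_{n-1}$. The broadcasting induced colouring of $\mathcal{T}_n$ with parameter $p$: the root is red or blue with probability $1/2$ each, and every other vertex, when added, receives the colour of its parent with probability $p$ and the other colour with probability $1-p$, independently of everything else. The root cluster $\mathcal{C}_n$ is the maximal monochromatic (connected) subtree of $\mathcal{T}_n$ containing the root, and $|\mathcal{C}_n|$ is its number of vertices. $\ln^{m}n$ means $(\ln n)^m$, and $a_n\sim b_n$ means $a_n/b_n\to1$. *)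

theory Defs
  imports "HOL-Probability.Probability" "HOL-Library.Landau_Symbols"
begin

datatype colour = Red | Blue

fun opposite :: "colour \<Rightarrow> colour" where
  "opposite Red = Blue"
| "opposite Blue = Red"

text \<open>
  Vertices are numbered in order of arrival, starting with the root \<open>0\<close>. An arc points from a
  parent to its child. Values of \<open>vcolour\<close> outside \<open>verts\<close> carry no meaning.
\<close>

record ctree =
  verts :: "nat set"
  arcs :: "(nat \<times> nat) set"
  vcolour :: "nat \<Rightarrow> colour"

definition single_vertex :: "colour \<Rightarrow> ctree" where
  "single_vertex c = \<lparr>verts = {0}, arcs = {}, vcolour = (\<lambda>_. c)\<rparr>"

definition add_child :: "ctree \<Rightarrow> nat \<Rightarrow> colour \<Rightarrow> ctree" where
  "add_child t v c = (let w = card (verts t) in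
     \<lparr>verts = insert w (verts t), arcs = insert (v, w) (arcs t), vcolour = (vcolour t)(w := c)\<rparr>)"

definition num_children :: "ctree \<Rightarrow> nat \<Rightarrow> nat" where
  "num_children t u = card {v. (u, v) \<in> arcs t}"

definition weight :: "nat \<Rightarrow> ctree \<Rightarrow> nat \<Rightarrow> real" where
  "weight d t u = 1 - real (num_children t u) / real d"

text \<open>
  \<open>embed_pmf\<close> is only meaningful for nonnegative functions with total mass 1; the lemma
  \<open>pmf_choose_parent\<close> below shows that this holds for every tree that can occur.
\<close>

definition choose_parent :: "nat \<Rightarrow> ctree \<Rightarrow> nat pmf" where
  "choose_parent d t =
     embed_pmf (\<lambda>v. if v \<in> verts t then weight d t v / (\<Sum>u\<in>verts t. weight d t u) else 0)"

definition grow :: "nat \<Rightarrow> real \<Rightarrow> ctree \<Rightarrow> ctree pmf" where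
  "grow d p t = do {
     v \<leftarrow> choose_parent d t;
     same \<leftarrow> bernoulli_pmf p;
     return_pmf (add_child t v (if same then vcolour t v else opposite (vcolour t v)))
   }"

text \<open>
  The law of the tree with \<open>n \<ge> 1\<close> vertices and its colouring; the value at \<open>n = 0\<close> is a dummy.
\<close>

fun coloured_tree :: "nat \<Rightarrow> real \<Rightarrow> nat \<Rightarrow> ctree pmf" where
  "coloured_tree d p 0 = return_pmf (single_vertex Red)"
| "coloured_tree d p (Suc 0) = map_pmf single_vertex (pmf_of_set {Red, Blue})"
| "coloured_tree d p (Suc (Suc n)) = bind_pmf (coloured_tree d p (Suc n)) (grow d p)"

definition connected_set :: "ctree \<Rightarrow> nat set \<Rightarrow> bool" where
  "connected_set t S \<longleftrightarrow>
     (\<forall>u\<in>S. \<forall>v\<in>S. (u, v) \<in> ((arcs t \<union> (arcs t)\<inverse>) \<inter> S \<times> S)\<^sup>*)"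

definition mono_root_subtree :: "ctree \<Rightarrow> nat set \<Rightarrow> bool" where
  "mono_root_subtree t S \<longleftrightarrow>
     0 \<in> S \<and> S \<subseteq> verts t \<and> connected_set t S \<and> (\<forall>u\<in>S. \<forall>v\<in>S. vcolour t u = vcolour t v)"

text \<open>
  The union of all monochromatic subtrees containing the root is itself one, hence the maximal
  one; see \<open>root_cluster_greatest\<close> below.
\<close>

definition root_cluster :: "ctree \<Rightarrow> nat set" where
  "root_cluster t = \<Union> {S. mono_root_subtree t S}"

lemma root_cluster_greatest:
  assumes "0 \<in> verts t"
  shows "mono_root_subtree t (root_cluster t)"
    and "mono_root_subtree t S \<Longrightarrow> S \<subseteq> root_cluster t"
proof -
  let ?R = "\<lambda>S. (arcs t \<union> (arcs t)\<inverse>) \<inter> S \<times> S"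
  let ?C = "root_cluster t"
  have sing: "mono_root_subtree t {0}"
    using assms by (simp add: mono_root_subtree_def connected_set_def)
  have root: "(u, 0) \<in> (?R ?C)\<^sup>* \<and> (0, u) \<in> (?R ?C)\<^sup>* \<and> vcolour t u = vcolour t 0 \<and> u \<in> verts t"
    if "u \<in> ?C" for u
  proof -
    from that obtain S where S: "mono_root_subtree t S" "u \<in> S"
      by (auto simp: root_cluster_def)
    then have "?R S \<subseteq> ?R ?C" by (auto simp: root_cluster_def)
    then have "(?R S)\<^sup>* \<subseteq> (?R ?C)\<^sup>*" by (rule rtrancl_mono)
    with S show ?thesis
      unfolding mono_root_subtree_def connected_set_def by blast
  qed
  have "connected_set t ?C"
    unfolding connected_set_def using root by (meson rtrancl_trans)
  moreover have "0 \<in> ?C" using sing by (auto simp: root_cluster_def)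
  ultimately show "mono_root_subtree t ?C"
    unfolding mono_root_subtree_def using root by (metis subsetI)
  show "mono_root_subtree t S \<Longrightarrow> S \<subseteq> ?C"
    by (auto simp: root_cluster_def)
qed

definition admissible :: "nat \<Rightarrow> nat \<Rightarrow> ctree \<Rightarrow> bool" where
  "admissible d n t \<longleftrightarrow> verts t = {..<n} \<and> arcs t \<subseteq> {..<n} \<times> {..<n} \<and>
     card (arcs t) = n - 1 \<and> (\<forall>u. num_children t u \<le> d)"

lemma admissible_pmf_choose_parent:
  assumes "d \<ge> 1" "n \<ge> 1" "admissible d n t"
  shows "pmf (choose_parent d t) v =
     (if v \<in> verts t then weight d t v / (\<Sum>u\<in>verts t. weight d t u) else 0)"
proof -
  let ?s = "\<Sum>u\<in>verts t. weight d t u"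
  have V: "verts t = {..<n}" and A: "arcs t \<subseteq> {..<n} \<times> {..<n}" and c: "card (arcs t) = n - 1"
    and deg: "\<And>u. num_children t u \<le> d"
    using assms(3) by (auto simp: admissible_def)
  have w0: "weight d t u \<ge> 0" for u
    using deg[of u] assms(1) by (simp add: weight_def field_simps)
  have "arcs t = (SIGMA u:{..<n}. {v. (u, v) \<in> arcs t})" using A by auto
  moreover have "finite {v. (u, v) \<in> arcs t}" for u
    by (rule finite_subset[of _ "{..<n}"]) (use A in auto)
  ultimately have "(\<Sum>u<n. num_children t u) = n - 1"
    using c by (metis (no_types, lifting) card_SigmaI finite_lessThan num_children_def sum.cong)
  then have "(\<Sum>u<n. real (num_children t u)) = real n - 1"
    using assms(2) by (metis of_nat_1 of_nat_diff of_nat_sum)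
  then have "?s = real n - (real n - 1) / real d"
    by (simp add: V weight_def sum_subtractf flip: sum_divide_distrib)
  moreover have "(real n - 1) / real d \<le> real n - 1"
    using assms(1,2) mult_left_mono[of 1 "real d" "real n - 1"] by (simp add: divide_le_eq)
  ultimately have s0: "?s > 0" by linarith
  show ?thesis
    unfolding choose_parent_def
  proof (rule pmf_embed_pmf)
    show "0 \<le> (if v \<in> verts t then weight d t v / ?s else 0)" for v
      using w0 s0 by simp
    let ?f = "\<lambda>v. if v \<in> verts t then weight d t v / ?s else 0"
    have "(\<integral>\<^sup>+v. ennreal (?f v) \<partial>count_space UNIV) = (\<Sum>v\<in>verts t. ennreal (?f v))"
      by (rule nn_integral_count_space'[of "verts t"]) (auto simp: V)
    also have "\<dots> = ennreal (\<Sum>v\<in>verts t. ?f v)"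
      using w0 s0 by (intro sum_ennreal) auto
    also have "(\<Sum>v\<in>verts t. ?f v) = 1"
      using s0 by (simp flip: sum_divide_distrib)
    finally show "(\<integral>\<^sup>+v. ennreal (?f v) \<partial>count_space UNIV) = 1" by simp
  qed
qed

lemma admissible_add_child:
  assumes "d \<ge> 1" "n \<ge> 1" "admissible d n t" "v \<in> set_pmf (choose_parent d t)"
  shows "admissible d (Suc n) (add_child t v c)"
proof -
  have V: "verts t = {..<n}" and A: "arcs t \<subseteq> {..<n} \<times> {..<n}" and card: "card (arcs t) = n - 1"
    and deg: "\<And>u. num_children t u \<le> d"
    using assms(3) by (auto simp: admissible_def)
  from assms(4) have "pmf (choose_parent d t) v \<noteq> 0" by (simp add: set_pmf_eq)
  then have v: "v < n" and "weight d t v \<noteq> 0"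
    unfolding admissible_pmf_choose_parent[OF assms(1-3)] using V by (auto split: if_splits)
  with assms(1) have "num_children t v \<noteq> d" by (auto simp: weight_def)
  with deg[of v] have vd: "num_children t v < d" by simp
  have fin: "finite (arcs t)" using A by (rule finite_subset) simp
  have new: "(v, n) \<notin> arcs t" using A by auto
  have "num_children (add_child t v c) u \<le> d" for u
  proof (cases "u = v")
    case True
    have "{w. (v, w) \<in> insert (v, n) (arcs t)} = insert n {w. (v, w) \<in> arcs t}" by auto
    moreover have "finite {w. (v, w) \<in> arcs t}"
      by (rule finite_subset[of _ "{..<n}"]) (use A in auto)
    ultimately have "num_children (add_child t v c) v \<le> Suc (num_children t v)"
      by (simp add: num_children_def add_child_def V Let_def card_insert_if del: insert_iff)
    with True vd show ?thesis by simp
  next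
    case False
    then show ?thesis using deg[of u] by (simp add: num_children_def add_child_def Let_def)
  qed
  then show ?thesis
    using A v card new fin assms(2) V
    by (auto simp: admissible_def add_child_def Let_def)
qed

lemma admissible_coloured_tree:
  assumes "d \<ge> 1" "n \<ge> 1" "t \<in> set_pmf (coloured_tree d p n)"
  shows "admissible d n t"
  using assms
proof (induction d p n arbitrary: t rule: coloured_tree.induct)
  case (2 d p)
  then show ?case by (auto simp: admissible_def single_vertex_def num_children_def)
next
  case (3 d p n)
  then show ?case
    by (auto simp: grow_def intro!: admissible_add_child)
qed simp

lemma pmf_choose_parent:
  assumes "d \<ge> 1" "n \<ge> 1" "t \<in> set_pmf (coloured_tree d p n)"
  shows "pmf (choose_parent d t) v =
     (if v \<in> verts t then weight d t v / (\<Sum>u\<in>verts t. weight d t u) else 0)"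
  using admissible_pmf_choose_parent[OF assms(1,2) admissible_coloured_tree[OF assms]] .

end

theory Submission
  imports Defs "HOL-Real_Asymp.Real_Asymp"
begin

text \<open>
  Two numbers describe how the root cluster evolves: its size \<open>X\<close> and its number \<open>Y\<close> of open
  slots, where a vertex with \<open>c\<close> children has \<open>d - c\<close> of them. Since the \<open>n\<close> vertices of the tree
  have \<open>(d - 1) n + 1\<close> open slots altogether, the next vertex is attached to the cluster with
  probability \<open>Y / ((d - 1) n + 1)\<close>. It then joins the cluster with probability \<open>p\<close>, moving
  \<open>(X, Y)\<close> to \<open>(X + 1, Y + d - 1)\<close>, and closes a slot without joining otherwise, moving \<open>(X, Y)\<close>
  to \<open>(X, Y - 1)\<close>. So \<open>(X, Y)\<close> is a time-changed branching process (\<open>expectation_grow\<close>).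

  The value \<open>p = 1/d\<close> makes \<open>Y\<close> a martingale. Hence the increment of \<open>E[X^a Y^b]\<close> is
  \<open>1 / ((d - 1) n + 1)\<close> times a combination of moments \<open>E[X^a' Y^b']\<close> of strictly smaller weight,
  where \<open>X\<close> has weight 2 and \<open>Y\<close> has weight 1 (\<open>cluster_moment_Suc\<close>): the two terms
  of larger or equal weight, with \<open>X^a Y^(b + 1)\<close> and \<open>X^a Y^b\<close>, cancel
  (\<open>step_coeff_simps\<close>). Summing over \<open>n\<close> gains one factor \<open>ln n\<close> per unit of weight, so
  by induction on the weight \<open>E[X^a Y^b]\<close> is asymptotic to \<open>c(a, b) (ln n)^(2a + b - 1)\<close>, where the
  constants satisfy
  \<open>(2a + b - 1) c(a, b) = (b choose 2) c(a, b - 1) + a / (d (d - 1)) c(a - 1, b + 1)\<close>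
  (\<open>moment_asymptotics\<close>).

  It remains to see that \<open>c(k, 0)\<close> obeys the quadratic recursion for \<open>E(k)\<close>. With \<open>\<kappa> = 1 / (d (d - 1))\<close>,
  the linear recursion says that the exponential generating function
  \<open>F(t, x, y) = (\<Sum>a b. c(a, b) x^a y^b t^(2a + b - 1) / (a! b!))\<close>
  solves \<open>\<partial>\<^sub>t F = (y^2 / 2 + \<kappa> x) \<partial>\<^sub>y F\<close> with \<open>F = d y\<close> at \<open>t = 0\<close>. The characteristics of this
  equation form a flow, and the flow solves its own ordinary differential equation: \<open>\<Phi> = F / d\<close> is
  also the solution of the Riccati equation \<open>\<partial>\<^sub>t \<Phi> = \<Phi>^2 / 2 + \<kappa> x\<close>. At \<open>y = 0\<close> the
  coefficients of \<open>F\<close> are \<open>E(k) / k!\<close>, and the square becomes the convolution in the claim. The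
  exponent of \<open>x\<close> can be read off from those of \<open>t\<close> and \<open>y\<close>, so nothing is lost by setting
  \<open>x = 1\<close>, and the argument takes place among polynomials in \<open>y\<close> (\<open>lie_poly_riccati\<close>,
  \<open>moment_const_convolution\<close>).
\<close>

section \<open>Evolution of the root cluster\<close>

text \<open>
  Along a path whose arcs join vertices of equal colour, the colour never changes. So the root
  cluster is a reachability class of this relation, and a new vertex alters it by at most one edge.
\<close>

definition cluster_arcs :: "ctree \<Rightarrow> (nat \<times> nat) set" where
  "cluster_arcs t = {(u, v) \<in> arcs t \<union> (arcs t)\<inverse>. vcolour t u = vcolour t v}"

lemma root_cluster_eq_reachable:
  assumes "0 \<in> verts t" "arcs t \<subseteq> verts t \<times> verts t"
  shows "root_cluster t = {u. (0, u) \<in> (cluster_arcs t)\<^sup>*}"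
proof
  have "(0, u) \<in> (cluster_arcs t)\<^sup>*" if S: "mono_root_subtree t S" and u: "u \<in> S" for S u
  proof -
    have "(0, u) \<in> ((arcs t \<union> (arcs t)\<inverse>) \<inter> S \<times> S)\<^sup>*"
      using S u by (auto simp: mono_root_subtree_def connected_set_def)
    moreover have "(arcs t \<union> (arcs t)\<inverse>) \<inter> S \<times> S \<subseteq> cluster_arcs t"
      using S by (auto simp: mono_root_subtree_def cluster_arcs_def)
    then have "((arcs t \<union> (arcs t)\<inverse>) \<inter> S \<times> S)\<^sup>* \<subseteq> (cluster_arcs t)\<^sup>*"
      by (rule rtrancl_mono)
    ultimately show ?thesis by (rule subsetD[rotated])
  qed
  then show "root_cluster t \<subseteq> {u. (0, u) \<in> (cluster_arcs t)\<^sup>*}"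
    by (auto simp: root_cluster_def)
next
  let ?S = "{u. (0, u) \<in> (cluster_arcs t)\<^sup>*}"
  let ?R = "(arcs t \<union> (arcs t)\<inverse>) \<inter> ?S \<times> ?S"
  have path: "(0, u) \<in> ?R\<^sup>* \<and> vcolour t u = vcolour t 0 \<and> u \<in> verts t"
    if "(0, u) \<in> (cluster_arcs t)\<^sup>*" for u
    using that
  proof (induction rule: rtrancl_induct)
    case (step u v)
    have "(0, v) \<in> (cluster_arcs t)\<^sup>*" using step.hyps by (rule rtrancl_into_rtrancl)
    then have "(u, v) \<in> ?R"
      using step.hyps by (simp add: cluster_arcs_def)
    with conjunct1[OF step.IH] have "(0, v) \<in> ?R\<^sup>*" by (rule rtrancl_into_rtrancl)
    moreover have "vcolour t v = vcolour t u" "v \<in> verts t"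
      using step.hyps(2) assms(2) by (auto simp: cluster_arcs_def)
    ultimately show ?case using step.IH by simp
  qed (use assms in simp)
  have "sym ?R" by (auto simp: sym_def)
  then have "sym (?R\<^sup>*)" by (rule sym_rtrancl)
  have "(u, v) \<in> ?R\<^sup>*" if "u \<in> ?S" "v \<in> ?S" for u v
  proof (rule rtrancl_trans)
    have "(0, u) \<in> ?R\<^sup>*" using path that(1) by simp
    with \<open>sym (?R\<^sup>*)\<close> show "(u, 0) \<in> ?R\<^sup>*" by (rule symD)
    show "(0, v) \<in> ?R\<^sup>*" using path that(2) by simp
  qed
  then have "connected_set t ?S"
    unfolding connected_set_def by (intro ballI)
  moreover have "?S \<subseteq> verts t"
    using path by (intro subsetI) simp
  moreover have "vcolour t u = vcolour t v" if "u \<in> ?S" "v \<in> ?S" for u v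
    using path[of u] path[of v] that by simp
  moreover have "0 \<in> ?S" by simp
  ultimately have "mono_root_subtree t ?S"
    unfolding mono_root_subtree_def by (intro conjI ballI)
  then show "?S \<subseteq> root_cluster t"
    unfolding root_cluster_def by (intro Union_upper CollectI)
qed

lemma admissibleD:
  assumes "admissible d n t"
  shows "verts t = {..<n}" "arcs t \<subseteq> {..<n} \<times> {..<n}" "card (arcs t) = n - 1"
    "num_children t u \<le> d"
  using assms by (auto simp: admissible_def)

lemma root_cluster_subset_verts: "root_cluster t \<subseteq> verts t"
  by (auto simp: root_cluster_def mono_root_subtree_def)

text \<open>
  The new vertex is a leaf: a monochromatic path from the root can pass through it only by going
  back along the arc it came from. So it makes no old vertex newly reachable.
\<close>

lemma root_cluster_add_child:
  assumes t: "admissible d n t" and n: "n \<ge> 1" and v: "v < n"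
  shows "root_cluster (add_child t v c) =
     (if v \<in> root_cluster t \<and> c = vcolour t v then insert n (root_cluster t) else root_cluster t)"
proof -
  note ad = admissibleD[OF t]
  let ?t = "add_child t v c"
  let ?M = "cluster_arcs t" and ?M' = "cluster_arcs ?t"
  have t': "verts ?t = insert n {..<n}" "arcs ?t = insert (v, n) (arcs t)" "vcolour ?t = (vcolour t)(n := c)"
    by (simp_all add: add_child_def ad Let_def)
  have M': "?M' = ?M \<union> (if c = vcolour t v then {(v, n), (n, v)} else {})"
    using ad(2) v by (auto simp: cluster_arcs_def t')
  have M: "x < n \<and> y < n" if "(x, y) \<in> ?M" for x y
    using that ad(2) by (auto simp: cluster_arcs_def)
  have C: "root_cluster t = {u. (0, u) \<in> ?M\<^sup>*}"
    using ad n by (intro root_cluster_eq_reachable) auto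
  have C': "root_cluster ?t = {u. (0, u) \<in> ?M'\<^sup>*}"
    using ad(2) n v by (intro root_cluster_eq_reachable) (auto simp: t')
  have reach: "if u = n then (0, v) \<in> ?M\<^sup>* \<and> c = vcolour t v else (0, u) \<in> ?M\<^sup>*"
    if "(0, u) \<in> ?M'\<^sup>*" for u
    using that
  proof (induction rule: rtrancl_induct)
    case base
    show ?case using n by simp
  next
    case (step x y)
    show ?case
    proof (cases "(x, y) \<in> ?M")
      case True
      with M have "x < n" "y < n" by auto
      with step.IH have "(0, x) \<in> ?M\<^sup>*" by simp
      with True have "(0, y) \<in> ?M\<^sup>*" by (meson rtrancl_into_rtrancl)
      with \<open>y < n\<close> show ?thesis by simp
    next
      case False
      with step.hyps(2) have "c = vcolour t v" "(x, y) = (v, n) \<or> (x, y) = (n, v)"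
        unfolding M' by (auto split: if_splits)
      with step.IH v show ?thesis by auto
    qed
  qed
  have mono: "?M\<^sup>* \<subseteq> ?M'\<^sup>*" unfolding M' by (intro rtrancl_mono) auto
  show ?thesis
  proof (cases "v \<in> root_cluster t \<and> c = vcolour t v")
    case True
    then have "(0, v) \<in> ?M'\<^sup>*" using mono by (auto simp: C)
    moreover have "(v, n) \<in> ?M'" using True unfolding M' by simp
    ultimately have "(0, n) \<in> ?M'\<^sup>*" by (rule rtrancl_into_rtrancl)
    then have "root_cluster ?t = insert n (root_cluster t)"
      using mono reach by (auto simp: C C' split: if_splits)
    with True show ?thesis by simp
  next
    case False
    have "(0, u) \<in> ?M\<^sup>*" if "(0, u) \<in> ?M'\<^sup>*" for u
      using reach[OF that] False by (simp add: C split: if_splits)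
    then have "root_cluster ?t = root_cluster t"
      using mono by (auto simp: C C')
    with False show ?thesis by auto
  qed
qed

text \<open>
  This is \<open>d\<close> times the total attachment weight of the cluster, which makes its jumps integral.
\<close>

definition cluster_slots :: "nat \<Rightarrow> ctree \<Rightarrow> real" where
  "cluster_slots d t = (\<Sum>u\<in>root_cluster t. real d - real (num_children t u))"

lemma num_children_add_child:
  assumes t: "admissible d n t" and v: "v < n"
  shows "num_children (add_child t v c) u = num_children t u + (if u = v then 1 else 0)"
proof -
  note ad = admissibleD[OF t]
  have fin: "finite {w. (v, w) \<in> arcs t}"
    by (rule finite_subset[of _ "{..<n}"]) (use ad in auto)
  have new: "(v, n) \<notin> arcs t" using ad(2) by auto
  have a: "arcs (add_child t v c) = insert (v, n) (arcs t)"
    by (simp add: add_child_def ad Let_def)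
  show ?thesis
  proof (cases "u = v")
    case True
    have "{w. (v, w) \<in> insert (v, n) (arcs t)} = insert n {w. (v, w) \<in> arcs t}" by auto
    then show ?thesis using True fin new by (simp add: num_children_def a del: insert_iff)
  next
    case False
    then show ?thesis by (simp add: num_children_def a)
  qed
qed

lemma num_children_new:
  assumes t: "admissible d n t"
  shows "num_children t n = 0"
proof -
  have "{w. (n, w) \<in> arcs t} = {}" using admissibleD(2)[OF t] by auto
  then show ?thesis by (simp add: num_children_def)
qed

text \<open>
  Attaching a child to a cluster vertex uses up one slot there; if the child joins the cluster, it
  brings \<open>d\<close> slots of its own.
\<close>

lemma cluster_add_child:
  assumes t: "admissible d n t" and n: "n \<ge> 1" and v: "v < n"
  shows "card (root_cluster (add_child t v c)) =
      card (root_cluster t) + (if v \<in> root_cluster t \<and> c = vcolour t v then 1 else 0)"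
    and "cluster_slots d (add_child t v c) = cluster_slots d t
      + (if v \<in> root_cluster t then if c = vcolour t v then real d - 1 else -1 else 0)"
proof -
  note ad = admissibleD[OF t]
  have sub: "root_cluster t \<subseteq> {..<n}" using root_cluster_subset_verts ad by metis
  then have fin: "finite (root_cluster t)" and new: "n \<notin> root_cluster t"
    by (auto intro: finite_subset)
  show "card (root_cluster (add_child t v c)) =
      card (root_cluster t) + (if v \<in> root_cluster t \<and> c = vcolour t v then 1 else 0)"
    using fin new by (simp add: root_cluster_add_child[OF assms])
  have "(\<Sum>u\<in>root_cluster t. real d - real (num_children (add_child t v c) u))
     = (\<Sum>u\<in>root_cluster t. (real d - real (num_children t u)) - (if u = v then 1 else 0))" for c
    by (intro sum.cong) (auto simp: num_children_add_child[OF t v])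
  moreover have "(\<Sum>u\<in>root_cluster t. (real d - real (num_children t u)) - (if u = v then 1 else 0))
     = cluster_slots d t - (if v \<in> root_cluster t then 1 else 0)"
    using fin by (simp add: sum_subtractf cluster_slots_def)
  ultimately have old: "(\<Sum>u\<in>root_cluster t. real d - real (num_children (add_child t v c) u))
     = cluster_slots d t - (if v \<in> root_cluster t then 1 else 0)" for c
    by simp
  have "num_children (add_child t v c) n = 0" for c
    using v by (simp add: num_children_add_child[OF t v] num_children_new[OF t])
  then show "cluster_slots d (add_child t v c) = cluster_slots d t
      + (if v \<in> root_cluster t then if c = vcolour t v then real d - 1 else -1 else 0)"
    using old fin new 
    by (simp add: cluster_slots_def[of d "add_child t v c"] root_cluster_add_child[OF assms])
qed

lemma sum_num_children:
  assumes "admissible d n t" "n \<ge> 1"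
  shows "(\<Sum>u<n. real (num_children t u)) = real n - 1"
proof -
  note ad = admissibleD[OF assms(1)]
  have "arcs t = (SIGMA u:{..<n}. {v. (u, v) \<in> arcs t})" using ad(2) by auto
  moreover have "finite {v. (u, v) \<in> arcs t}" for u
    by (rule finite_subset[of _ "{..<n}"]) (use ad in auto)
  ultimately have "(\<Sum>u<n. num_children t u) = n - 1"
    using ad(3) by (metis (no_types, lifting) card_SigmaI finite_lessThan num_children_def sum.cong)
  then show ?thesis using assms(2) by (metis of_nat_1 of_nat_diff of_nat_sum)
qed

lemma sum_weight:
  assumes "admissible d n t" "n \<ge> 1" "d \<ge> 1"
  shows "(\<Sum>u\<in>verts t. weight d t u) = ((real d - 1) * real n + 1) / real d"
proof -
  have "(\<Sum>u\<in>verts t. weight d t u) = real n - (real n - 1) / real d"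
    using sum_num_children[OF assms(1,2)] admissibleD(1)[OF assms(1)]
    by (simp add: weight_def sum_subtractf flip: sum_divide_distrib)
  also have "\<dots> = ((real d - 1) * real n + 1) / real d"
    using assms by (simp add: field_simps)
  finally show ?thesis .
qed

lemma pmf_choose_parent_admissible:
  assumes "admissible d n t" "n \<ge> 1" "d \<ge> 1"
  shows "pmf (choose_parent d t) v =
    (if v < n then (real d - real (num_children t v)) / ((real d - 1) * real n + 1) else 0)"
proof -
  have "weight d t v = (real d - real (num_children t v)) / real d"
    using assms by (simp add: weight_def field_simps)
  then show ?thesis
    using assms(3)
    by (simp add: admissible_pmf_choose_parent[OF assms(3,2,1)] sum_weight[OF assms])
       (simp add: admissibleD(1)[OF assms(1)])
qed

lemma set_pmf_choose_parent:
  assumes "admissible d n t" "n \<ge> 1" "d \<ge> 1"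
  shows "set_pmf (choose_parent d t) \<subseteq> {..<n}"
  using pmf_choose_parent_admissible[OF assms] by (auto simp: set_pmf_eq split: if_splits)

lemma finite_set_pmf_grow:
  assumes "admissible d n t" "n \<ge> 1" "d \<ge> 1"
  shows "finite (set_pmf (grow d p t))"
  using finite_subset[OF set_pmf_choose_parent[OF assms]] by (auto simp: grow_def)

lemma finite_set_pmf_coloured_tree:
  assumes "d \<ge> 1"
  shows "finite (set_pmf (coloured_tree d p n))"
proof (induction n)
  case (Suc n)
  show ?case
  proof (cases n)
    case (Suc m)
    have "finite (set_pmf (grow d p t))" if "t \<in> set_pmf (coloured_tree d p n)" for t
      using that assms Suc by (intro finite_set_pmf_grow[of d n] admissible_coloured_tree[of d n t p]) auto
    then show ?thesis using Suc.IH Suc by auto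
  qed auto
qed auto

text \<open>
  This is where trees disappear: for given \<open>n\<close>, the right-hand side involves the tree only through
  the size and the slots of its root cluster, which therefore form a Markov chain.
\<close>

lemma expectation_grow:
  fixes h :: "nat \<Rightarrow> real \<Rightarrow> real"
  assumes t: "admissible d n t" and n: "n \<ge> 1" and d: "d \<ge> 1" and p: "0 \<le> p" "p \<le> 1"
  defines "X \<equiv> card (root_cluster t)" and "Y \<equiv> cluster_slots d t"
  shows "measure_pmf.expectation (grow d p t) (\<lambda>t. h (card (root_cluster t)) (cluster_slots d t))
     = h X Y + Y * (p * h (X + 1) (Y + (real d - 1)) + (1 - p) * h X (Y - 1) - h X Y)
         / ((real d - 1) * real n + 1)"
proof -
  let ?f = "\<lambda>t. h (card (root_cluster t)) (cluster_slots d t)"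
  let ?C = "root_cluster t" and ?P = "choose_parent d t"
  define g where "g v same = add_child t v (if same then vcolour t v else opposite (vcolour t v))" for v same
  define \<Delta> where "\<Delta> = p * h (X + 1) (Y + (real d - 1)) + (1 - p) * h X (Y - 1) - h X Y"
  have opp: "opposite c \<noteq> c" for c by (cases c) auto
  have sub: "?C \<subseteq> {..<n}" using root_cluster_subset_verts admissibleD(1)[OF t] by metis
  have grow: "grow d p t = ?P \<bind> (\<lambda>v. map_pmf (g v) (bernoulli_pmf p))"
    by (simp add: grow_def g_def map_pmf_def)
  have "measure_pmf.expectation (grow d p t) ?f
     = (\<Sum>v<n. pmf ?P v *\<^sub>R measure_pmf.expectation (map_pmf (g v) (bernoulli_pmf p)) ?f)"
    unfolding grow by (rule pmf_expectation_bind) (use set_pmf_choose_parent[OF t n d] in auto)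
  also have "\<dots> = (\<Sum>v<n. pmf ?P v * (h X Y + (if v \<in> ?C then \<Delta> else 0)))"
  proof (intro sum.cong refl)
    fix v assume "v \<in> {..<n}"
    then have v: "v < n" by simp
    have "measure_pmf.expectation (map_pmf (g v) (bernoulli_pmf p)) ?f = 
       ?f (g v True) * p + ?f (g v False) * (1 - p)"
      using p by simp
    also have "\<dots> = h X Y + (if v \<in> ?C then \<Delta> else 0)"
      by (simp add: g_def cluster_add_child[OF t n v] opp opp[symmetric] X_def Y_def \<Delta>_def algebra_simps)
    finally show "pmf ?P v *\<^sub>R measure_pmf.expectation (map_pmf (g v) (bernoulli_pmf p)) ?f
        = pmf ?P v * (h X Y + (if v \<in> ?C then \<Delta> else 0))" by simp
  qed
  also have "\<dots> = h X Y * (\<Sum>v<n. pmf ?P v) + \<Delta> * (\<Sum>v\<in>?C. pmf ?P v)"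
  proof -
    have "(\<Sum>v<n. pmf ?P v * (if v \<in> ?C then \<Delta> else 0)) = (\<Sum>v<n. if v \<in> ?C then pmf ?P v * \<Delta> else 0)"
      by (intro sum.cong) auto
    also have "\<dots> = (\<Sum>v\<in>{..<n} \<inter> ?C. pmf ?P v * \<Delta>)"
      by (simp add: sum.inter_restrict)
    also have "{..<n} \<inter> ?C = ?C" using sub by auto
    finally show ?thesis
      by (simp add: distrib_left sum.distrib sum_distrib_left mult.commute)
  qed
  also have "(\<Sum>v<n. pmf ?P v) = 1"
    by (rule sum_pmf_eq_1) (use set_pmf_choose_parent[OF t n d] in auto)
  also have "(\<Sum>v\<in>?C. pmf ?P v) = Y / ((real d - 1) * real n + 1)"
    using sub by (auto simp: Y_def cluster_slots_def pmf_choose_parent_admissible[OF t n d] 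
        sum_divide_distrib intro!: sum.cong)
  finally show ?thesis by (simp add: \<Delta>_def)
qed

section \<open>Recursion for the joint moments of size and open slots\<close>

text \<open>
  The coefficient of \<open>X^(a - i) Y^(b - j)\<close> in
  \<open>(X + 1)^a (Y + d - 1)^b / d + (1 - 1/d) X^a (Y - 1)^b - X^a Y^b\<close>, the mean change of \<open>X^a Y^b\<close>
  when a child is attached to the cluster.
\<close>

definition step_coeff :: "nat \<Rightarrow> nat \<Rightarrow> nat \<Rightarrow> nat \<Rightarrow> nat \<Rightarrow> real" where
  "step_coeff d a b i j = real (a choose i) * real (b choose j) *
     (1 / real d * (real d - 1) ^ j
      + (if i = 0 then (1 - 1 / real d) * (-1) ^ j - (if j = 0 then 1 else 0) else 0))"

text \<open>
  The first two equations express that probabilities sum to one and that the slots have mean change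
  zero at \<open>p = 1/d\<close>. The other two coefficients are those of the terms with \<open>2 * i + j = 2\<close>, the
  only ones that matter to leading order.
\<close>

lemma step_coeff_simps:
  assumes "d \<ge> 2"
  shows "step_coeff d a b 0 0 = 0" "step_coeff d a b 0 (Suc 0) = 0"
    "step_coeff d a b 0 2 = real (b choose 2) * (real d - 1)"
    "step_coeff d a b (Suc 0) 0 = real a / real d"
  using assms by (simp_all add: step_coeff_def field_simps power2_eq_square)

definition cluster_moment :: "nat \<Rightarrow> real \<Rightarrow> nat \<Rightarrow> nat \<Rightarrow> nat \<Rightarrow> real" where
  "cluster_moment d p a b n = measure_pmf.expectation (coloured_tree d p n)
     (\<lambda>t. real (card (root_cluster t)) ^ a * cluster_slots d t ^ b)"

text \<open>
  The factor \<open>Y\<close> in front, proportional to the probability that the cluster is hit, raises the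
  exponent of \<open>Y\<close> to \<open>b - j + 1\<close>.
\<close>

lemma step_expansion:
  fixes X Y :: real
  shows "Y * (1 / real d * ((X + 1) ^ a * (Y + (real d - 1)) ^ b)
          + (1 - 1 / real d) * (X ^ a * (Y - 1) ^ b) - X ^ a * Y ^ b)
    = (\<Sum>i\<le>a. \<Sum>j\<le>b. step_coeff d a b i j * (X ^ (a - i) * Y ^ (b - j + 1)))"
proof -
  have both: "(x + X) ^ a * (y + Y) ^ b
    = (\<Sum>i\<le>a. \<Sum>j\<le>b. real (a choose i) * real (b choose j) * x ^ i * y ^ j * (X ^ (a - i) * Y ^ (b - j)))"
    for x y
    by (simp add: binomial_ring sum_product mult_ac)
  (* 0 ^ i and 0 ^ j serve as indicators of i = 0 and j = 0, so that all three parts of the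
     coefficient have the shape of the expansion above. *)
  have *: "step_coeff d a b i j * (X ^ (a - i) * Y ^ (b - j + 1)) = Y * (
       1 / real d * (real (a choose i) * real (b choose j) * 1 ^ i * (real d - 1) ^ j * (X ^ (a - i) * Y ^ (b - j)))
     + (1 - 1 / real d) * (real (a choose i) * real (b choose j) * 0 ^ i * (- 1) ^ j * (X ^ (a - i) * Y ^ (b - j)))
     - real (a choose i) * real (b choose j) * 0 ^ i * 0 ^ j * (X ^ (a - i) * Y ^ (b - j)))" for i j
    unfolding step_coeff_def by (cases "i = 0"; cases "j = 0") (simp_all add: algebra_simps power_0_left)
  have "(\<Sum>i\<le>a. \<Sum>j\<le>b. step_coeff d a b i j * (X ^ (a - i) * Y ^ (b - j + 1)))
    = Y * (1 / real d * ((1 + X) ^ a * ((real d - 1) + Y) ^ b)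
          + (1 - 1 / real d) * ((0 + X) ^ a * (- 1 + Y) ^ b) - (0 + X) ^ a * (0 + Y) ^ b)"
    unfolding * both by (simp only: sum_distrib_left distrib_left right_diff_distrib sum.distrib sum_subtractf)
  then show ?thesis by (simp add: add.commute)
qed

lemma cluster_moment_Suc:
  assumes d: "d \<ge> 2" and n: "n \<ge> 1"
  defines "p \<equiv> 1 / real d"
  shows "cluster_moment d p a b (Suc n) - cluster_moment d p a b n =
    (\<Sum>i\<le>a. \<Sum>j\<le>b. step_coeff d a b i j * cluster_moment d p (a - i) (b - j + 1) n)
      / ((real d - 1) * real n + 1)"
proof -
  let ?T = "coloured_tree d p n"
  let ?A = "set_pmf ?T"
  let ?X = "\<lambda>t. card (root_cluster t)" and ?Y = "cluster_slots d"
  define W where "W = (real d - 1) * real n + 1"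
  have d1: "d \<ge> 1" and p: "0 \<le> p" "p \<le> 1" using d by (auto simp: p_def)
  have fin: "finite ?A" using d1 by (rule finite_set_pmf_coloured_tree)
  have adm: "admissible d n t" if "t \<in> ?A" for t
    using that d1 n by (intro admissible_coloured_tree)
  have moment: "cluster_moment d p a' b' n = (\<Sum>t\<in>?A. pmf ?T t * (real (?X t) ^ a' * ?Y t ^ b'))" for a' b'
    unfolding cluster_moment_def by (subst integral_measure_pmf[OF fin]) auto
  have "coloured_tree d p (Suc n) = ?T \<bind> grow d p"
    using n by (cases n) auto
  then have "cluster_moment d p a b (Suc n)
    = (\<Sum>t\<in>?A. pmf ?T t *\<^sub>R measure_pmf.expectation (grow d p t) (\<lambda>t. real (?X t) ^ a * ?Y t ^ b))"
    unfolding cluster_moment_def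
    using fin adm d1 n by (simp only:) (intro pmf_expectation_bind finite_set_pmf_grow[of d n], auto)
  also have "\<dots> = (\<Sum>t\<in>?A. pmf ?T t * (real (?X t) ^ a * ?Y t ^ b)
      + pmf ?T t * (\<Sum>i\<le>a. \<Sum>j\<le>b. step_coeff d a b i j * (real (?X t) ^ (a - i) * ?Y t ^ (b - j + 1))) / W)"
  proof (intro sum.cong refl)
    fix t assume "t \<in> ?A"
    note expectation_grow[OF adm[OF this] n d1 p, of "\<lambda>x y. real x ^ a * y ^ b",
        unfolded of_nat_add of_nat_1 p_def step_expansion, folded p_def W_def]
    then show "pmf ?T t *\<^sub>R measure_pmf.expectation (grow d p t) (\<lambda>t. real (?X t) ^ a * ?Y t ^ b)
      = pmf ?T t * (real (?X t) ^ a * ?Y t ^ b)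
      + pmf ?T t * (\<Sum>i\<le>a. \<Sum>j\<le>b. step_coeff d a b i j * (real (?X t) ^ (a - i) * ?Y t ^ (b - j + 1))) / W"
      by (simp add: distrib_left)
  qed
  also have "\<dots> = cluster_moment d p a b n
     + (\<Sum>t\<in>?A. pmf ?T t * (\<Sum>i\<le>a. \<Sum>j\<le>b. step_coeff d a b i j * (real (?X t) ^ (a - i) * ?Y t ^ (b - j + 1)))) / W"
    by (simp add: sum.distrib moment sum_divide_distrib)
  also have "(\<Sum>t\<in>?A. pmf ?T t * (\<Sum>i\<le>a. \<Sum>j\<le>b. step_coeff d a b i j * (real (?X t) ^ (a - i) * ?Y t ^ (b - j + 1))))
    = (\<Sum>i\<le>a. \<Sum>j\<le>b. step_coeff d a b i j * cluster_moment d p (a - i) (b - j + 1) n)"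
  proof -
    let ?f = "\<lambda>t i j. step_coeff d a b i j * (real (?X t) ^ (a - i) * ?Y t ^ (b - j + 1))"
    have "(\<Sum>t\<in>?A. pmf ?T t * (\<Sum>i\<le>a. \<Sum>j\<le>b. ?f t i j)) = (\<Sum>t\<in>?A. \<Sum>i\<le>a. \<Sum>j\<le>b. pmf ?T t * ?f t i j)"
      by (simp only: sum_distrib_left)
    also have "\<dots> = (\<Sum>i\<le>a. \<Sum>t\<in>?A. \<Sum>j\<le>b. pmf ?T t * ?f t i j)"
      by (rule sum.swap)
    also have "\<dots> = (\<Sum>i\<le>a. \<Sum>j\<le>b. \<Sum>t\<in>?A. pmf ?T t * ?f t i j)"
      by (intro sum.cong refl sum.swap)
    finally show ?thesis
      unfolding moment sum_distrib_left by (simp only: mult.left_commute)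
  qed
  finally show ?thesis by (simp add: W_def)
qed

lemma root_cluster_single_vertex: "root_cluster (single_vertex c) = {0}"
proof -
  have "mono_root_subtree (single_vertex c) {0}"
    by (simp add: mono_root_subtree_def connected_set_def single_vertex_def)
  then show ?thesis
    using root_cluster_subset_verts[of "single_vertex c"]
    by (auto simp: root_cluster_def single_vertex_def)
qed

lemma cluster_moment_1: "cluster_moment d p a b 1 = real d ^ b"
  by (simp add: cluster_moment_def root_cluster_single_vertex cluster_slots_def)
     (simp add: num_children_def single_vertex_def)

section \<open>Sequences with increments of logarithmic order\<close>

text \<open>
  Subtracting \<open>l * v\<close> from \<open>u\<close> leaves a sequence whose increments are at most \<open>e / 2\<close> times those of
  \<open>v\<close>. Telescoping bounds it by \<open>e / 2 * v n\<close> up to a constant, and the constant is absorbed because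
  \<open>v\<close> is unbounded.
\<close>

lemma stolz_cesaro:
  fixes u v :: "nat \<Rightarrow> real"
  assumes mono: "eventually (\<lambda>n. v n < v (Suc n)) sequentially"
    and v_top: "filterlim v at_top sequentially"
    and lim: "(\<lambda>n. (u (Suc n) - u n) / (v (Suc n) - v n)) \<longlonglongrightarrow> l"
  shows "(\<lambda>n. u n / v n) \<longlonglongrightarrow> l"
proof (rule tendstoI)
  fix e :: real assume e: "e > 0"
  define w where "w n = u n - l * v n" for n
  have "eventually (\<lambda>n. dist ((u (Suc n) - u n) / (v (Suc n) - v n)) l < e / 2) sequentially"
    using lim e by (intro tendstoD) auto
  with mono have "eventually (\<lambda>n. v n < v (Suc n) \<and> 
     \<bar>w (Suc n) - w n\<bar> \<le> e / 2 * (v (Suc n) - v n)) sequentially"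
  proof eventually_elim
    case (elim n)
    define x where "x = v (Suc n) - v n"
    have x: "x > 0" using elim by (simp add: x_def)
    have "w (Suc n) - w n = ((u (Suc n) - u n) / x - l) * x"
      using x by (simp add: w_def x_def field_simps)
    then have "\<bar>w (Suc n) - w n\<bar> = \<bar>(u (Suc n) - u n) / x - l\<bar> * x"
      using x by (simp add: abs_mult)
    also have "\<dots> \<le> e / 2 * x"
      using elim x by (intro mult_right_mono) (auto simp: dist_real_def x_def)
    finally show ?case using elim by (simp add: x_def)
  qed
  then obtain M where M: "\<And>n. n \<ge> M \<Longrightarrow> \<bar>w (Suc n) - w n\<bar> \<le> e / 2 * (v (Suc n) - v n)"
    by (auto simp: eventually_sequentially)
  have bound: "\<bar>w n\<bar> \<le> \<bar>w M\<bar> + e / 2 * (v n - v M)" if "n \<ge> M" for n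
    using that
  proof (induction n rule: dec_induct)
    case (step n)
    have "\<bar>w (Suc n)\<bar> \<le> \<bar>w n\<bar> + \<bar>w (Suc n) - w n\<bar>" by linarith
    moreover have "e / 2 * (v (Suc n) - v n) + e / 2 * (v n - v M) = e / 2 * (v (Suc n) - v M)"
      by (simp add: field_simps)
    ultimately show ?case using step M[of n] by linarith
  qed simp
  have "eventually (\<lambda>n. v n > max 0 (2 * (\<bar>w M\<bar> + e / 2 * \<bar>v M\<bar>) / e)) sequentially"
    using v_top unfolding filterlim_at_top_dense by blast
  with eventually_ge_at_top[of M]
  show "eventually (\<lambda>n. dist (u n / v n) l < e) sequentially"
  proof eventually_elim
    case (elim n)
    have v: "v n > 0" using elim by simp
    have "\<bar>w M\<bar> + e / 2 * \<bar>v M\<bar> < e / 2 * v n"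
      using elim e by (auto simp: field_simps)
    moreover have "e / 2 * (- v M) \<le> e / 2 * \<bar>v M\<bar>"
      using e by (intro mult_left_mono) auto
    ultimately have "\<bar>w n\<bar> < e * v n"
      using bound[OF elim(1)] unfolding right_diff_distrib by linarith
    moreover have "u n / v n - l = w n / v n" using v by (simp add: w_def field_simps)
    ultimately show ?case using v by (simp add: dist_real_def field_simps)
  qed
qed

text \<open>
  With \<open>q n = ln (n + 1) / ln n\<close>, the difference of the powers is \<open>ln n ^ Suc s * (q n ^ Suc s - 1)\<close>.
  The geometric sum splits off \<open>ln n * (q n - 1) = ln (n + 1) - ln n\<close>, which is asymptotic to
  \<open>1 / n\<close>, and the sum itself tends to its number of terms.
\<close>

lemma tendsto_ln_power_increment:
  fixes D :: real
  assumes "D > 0"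
  shows "(\<lambda>n. (D * real n + 1) * (ln (real (Suc n)) ^ Suc s - ln (real n) ^ Suc s) / ln (real n) ^ s)
           \<longlonglongrightarrow> D * real (Suc s)"
proof -
  define q :: "nat \<Rightarrow> real" where "q n = ln (real n + 1) / ln (real n)" for n
  have "(\<lambda>n. (D * real n + 1) * (ln (real n + 1) - ln (real n))) \<longlonglongrightarrow> D"
    using assms by real_asymp
  moreover have q: "q \<longlonglongrightarrow> 1" unfolding q_def by real_asymp
  have "(\<lambda>n. \<Sum>i<Suc s. q n ^ i) \<longlonglongrightarrow> (\<Sum>i<Suc s. 1 ^ i)"
    by (intro tendsto_intros q)
  ultimately have "(\<lambda>n. (D * real n + 1) * (ln (real n + 1) - ln (real n)) * (\<Sum>i<Suc s. q n ^ i))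
      \<longlonglongrightarrow> D * (\<Sum>i<Suc s. 1 ^ i)"
    by (intro tendsto_mult)
  moreover have "eventually (\<lambda>n. (D * real n + 1) * (ln (real n + 1) - ln (real n)) * (\<Sum>i<Suc s. q n ^ i)
     = (D * real n + 1) * (ln (real (Suc n)) ^ Suc s - ln (real n) ^ Suc s) / ln (real n) ^ s) sequentially"
    using eventually_gt_at_top[of 1]
  proof eventually_elim
    case (elim n)
    have l: "ln (real n) > 0" using elim by simp
    have "q n ^ Suc s - 1 = (q n - 1) * (\<Sum>i<Suc s. q n ^ i)"
      by (rule power_diff_1_eq)
    then have a: "ln (real n) ^ Suc s * (q n ^ Suc s - 1)
         = ln (real n) ^ s * ((ln (real n) * (q n - 1)) * (\<Sum>i<Suc s. q n ^ i))"
      by simp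
    have b: "ln (real n) * (q n - 1) = ln (real n + 1) - ln (real n)"
      using l by (simp add: q_def field_simps)
    have c: "ln (real n) ^ Suc s * (q n ^ Suc s - 1) = ln (real (Suc n)) ^ Suc s - ln (real n) ^ Suc s"
      using l by (simp add: q_def power_divide field_simps)
    have "ln (real (Suc n)) ^ Suc s - ln (real n) ^ Suc s
        = ln (real n) ^ s * ((ln (real n + 1) - ln (real n)) * (\<Sum>i<Suc s. q n ^ i))"
      using a unfolding b c .
    then show ?case using l by simp
  qed
  ultimately show ?thesis by (simp add: filterlim_cong[OF refl refl])
qed

text \<open>
  Discrete counterpart of \<open>\<integral> (ln x)^s / x dx = (ln x)^(s + 1) / (s + 1)\<close>.
\<close>

lemma ln_power_asymptotics_of_increments:
  fixes u g :: "nat \<Rightarrow> real" and D :: real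
  assumes "D > 0"
    and step: "\<And>n. n \<ge> 1 \<Longrightarrow> u (Suc n) - u n = g n / (D * real n + 1)"
    and g: "(\<lambda>n. g n / ln (real n) ^ s) \<longlonglongrightarrow> l"
  shows "(\<lambda>n. u n / ln (real n) ^ Suc s) \<longlonglongrightarrow> l / (D * real (Suc s))"
proof (rule stolz_cesaro)
  show "eventually (\<lambda>n. ln (real n) ^ Suc s < ln (real (Suc n)) ^ Suc s) sequentially"
    using eventually_ge_at_top[of 1] by eventually_elim (intro power_strict_mono, auto)
  show "filterlim (\<lambda>n. ln (real n) ^ Suc s) at_top sequentially"
    by (intro filterlim_pow_at_top filterlim_compose[OF ln_at_top] filterlim_real_sequentially) simp
  let ?h = "\<lambda>n. (D * real n + 1) * (ln (real (Suc n)) ^ Suc s - ln (real n) ^ Suc s) / ln (real n) ^ s"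
  have "(\<lambda>n. (g n / ln (real n) ^ s) / ?h n) \<longlonglongrightarrow> l / (D * real (Suc s))"
    using \<open>D > 0\<close> by (intro tendsto_divide g tendsto_ln_power_increment) auto
  moreover have "eventually (\<lambda>n. (g n / ln (real n) ^ s) / ?h n = 
     (u (Suc n) - u n) / (ln (real (Suc n)) ^ Suc s - ln (real n) ^ Suc s)) sequentially"
    using eventually_gt_at_top[of 1]
  proof eventually_elim
    case (elim n)
    have "ln (real n) > 0" using elim by simp
    then have "ln (real n) ^ s \<noteq> 0" by simp
    then show ?case using step[of n] elim by simp
  qed
  ultimately show "(\<lambda>n. (u (Suc n) - u n) / (ln (real (Suc n)) ^ Suc s - ln (real n) ^ Suc s))
      \<longlonglongrightarrow> l / (D * real (Suc s))"
    by (simp add: filterlim_cong[OF refl refl])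
qed

section \<open>Lie series of a quadratic vector field\<close>

text \<open>
  \<open>lie_poly \<kappa> r\<close> is the coefficient of \<open>t^r\<close> in the flow, started at \<open>y\<close>, of the vector field
  \<open>(\<kappa> + y^2 / 2) d/dy\<close>: by Lie's formula it is the \<open>r\<close>-th iterate of this derivation applied to
  \<open>y\<close>, divided by \<open>r!\<close>.
\<close>

primrec lie_poly :: "real \<Rightarrow> nat \<Rightarrow> real poly" where
  "lie_poly \<kappa> 0 = [:0, 1:]"
| "lie_poly \<kappa> (Suc r) = smult (1 / real (Suc r)) ([:\<kappa>, 0, 1/2:] * pderiv (lie_poly \<kappa> r))"

text \<open>
  A flow \<open>\<Phi>\<close> solves both the transport equation \<open>\<partial>\<^sub>t \<Phi> = (\<kappa> + y^2 / 2) \<partial>\<^sub>y \<Phi>\<close>, which is the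
  definition of the coefficients, and the differential equation \<open>\<partial>\<^sub>t \<Phi> = \<kappa> + \<Phi>^2 / 2\<close>, whose
  coefficient of \<open>t^r\<close> is compared here. The second follows from the first because applying the
  derivation \<open>L\<close> to the identity at order \<open>r\<close> yields, by the product rule, the one at order \<open>Suc r\<close>:
  in the result, the product of the coefficients of orders \<open>i\<close> and \<open>Suc r - i\<close> arises once with
  factor \<open>i\<close> and once with factor \<open>Suc r - i\<close>.
\<close>

lemma lie_poly_riccati:
  "smult (real (Suc r)) (lie_poly \<kappa> (Suc r)) =
     smult (1/2) (\<Sum>i\<le>r. lie_poly \<kappa> i * lie_poly \<kappa> (r - i)) + (if r = 0 then [:\<kappa>:] else 0)"
proof (induction r)
  case 0
  show ?case by (simp add: pderiv_pCons)
next
  case (Suc r)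
  let ?Q = "lie_poly \<kappa>"
  define L where "L p = [:\<kappa>, 0, 1/2:] * pderiv p" for p :: "real poly"
  have L_add: "L (p + q) = L p + L q" and L_smult: "L (smult c p) = smult c (L p)"
    and L_mult: "L (p * q) = L p * q + p * L q" for p q c
    by (simp_all add: L_def pderiv_add pderiv_smult pderiv_mult algebra_simps smult_add_right
          del: mult_pCons_left mult_pCons_right)
  have L_0: "L 0 = 0" by (simp add: L_def)
  have L_sum: "L (sum f I) = (\<Sum>i\<in>I. L (f i))" for f :: "nat \<Rightarrow> real poly" and I
    by (induction I rule: infinite_finite_induct) (simp_all add: L_add L_0)
  have smult_sum: "smult c (sum f I) = (\<Sum>i\<in>I. smult c (f i))" for c and f :: "nat \<Rightarrow> real poly" and I
    by (induction I rule: infinite_finite_induct) (simp_all add: smult_add_right)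
  have L_Q: "L (?Q i) = smult (real (Suc i)) (?Q (Suc i))" for i
    by (simp add: L_def)
  have "smult (real (Suc r)) (smult (real (Suc (Suc r))) (?Q (Suc (Suc r))))
      = L (smult (real (Suc r)) (?Q (Suc r)))"
    by (simp only: L_smult L_Q)
  also have "\<dots> = smult (1/2) (\<Sum>i\<le>r. L (?Q i) * ?Q (r - i) + ?Q i * L (?Q (r - i)))"
    unfolding Suc.IH by (simp add: L_add L_smult L_sum L_mult L_0) (simp add: L_def)
  also have "(\<Sum>i\<le>r. L (?Q i) * ?Q (r - i) + ?Q i * L (?Q (r - i)))
      = (\<Sum>i\<le>r. smult (real (Suc i)) (?Q (Suc i) * ?Q (Suc r - Suc i)))
        + (\<Sum>i\<le>r. smult (real (Suc r - i)) (?Q i * ?Q (Suc r - i)))"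
    unfolding sum.distrib
    by (intro arg_cong2[where f = "(+)"] sum.cong refl) 
       (simp_all only: L_Q Suc_diff_le atMost_iff diff_Suc_Suc mult_smult_left mult_smult_right)
  also have "(\<Sum>i\<le>r. smult (real (Suc i)) (?Q (Suc i) * ?Q (Suc r - Suc i)))
      = (\<Sum>i\<le>Suc r. smult (real i) (?Q i * ?Q (Suc r - i)))"
    by (subst sum.atMost_Suc_shift) simp
  also have "(\<Sum>i\<le>r. smult (real (Suc r - i)) (?Q i * ?Q (Suc r - i)))
      = (\<Sum>i\<le>Suc r. smult (real (Suc r - i)) (?Q i * ?Q (Suc r - i)))"
    by (subst sum.atMost_Suc) simp
  also have "(\<Sum>i\<le>Suc r. smult (real i) (?Q i * ?Q (Suc r - i)))
        + (\<Sum>i\<le>Suc r. smult (real (Suc r - i)) (?Q i * ?Q (Suc r - i)))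
      = smult (real (Suc r)) (\<Sum>i\<le>Suc r. ?Q i * ?Q (Suc r - i))"
    unfolding smult_sum sum.distrib[symmetric]
    by (intro sum.cong refl) (simp only: smult_add_left[symmetric] of_nat_add[symmetric] atMost_iff le_add_diff_inverse)
  finally have "smult (real (Suc r)) (smult (real (Suc (Suc r))) (?Q (Suc (Suc r))))
      = smult (real (Suc r)) (smult (1/2) (\<Sum>i\<le>Suc r. ?Q i * ?Q (Suc r - i)))"
    by (simp only: smult_smult mult.commute)
  then have "smult (real (Suc (Suc r))) (?Q (Suc (Suc r))) = smult (1/2) (\<Sum>i\<le>Suc r. ?Q i * ?Q (Suc r - i))"
    by (drule_tac arg_cong[of _ _ "smult (1 / real (Suc r))"]) 
       (simp del: lie_poly.simps of_nat_Suc sum.atMost_Suc add: smult_smult)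
  then show ?case by (simp del: lie_poly.simps)
qed

lemma coeff_lie_poly_Suc:
  "real (Suc r) * coeff (lie_poly \<kappa> (Suc r)) b =
     \<kappa> * real (b + 1) * coeff (lie_poly \<kappa> r) (b + 1)
     + (if b = 0 then 0 else real (b - 1) / 2 * coeff (lie_poly \<kappa> r) (b - 1))"
proof -
  have "real (Suc r) * coeff (lie_poly \<kappa> (Suc r)) b = coeff ([:\<kappa>, 0, 1/2:] * pderiv (lie_poly \<kappa> r)) b"
    by (simp del: mult_pCons_left)
  also have "\<dots> = \<kappa> * real (b + 1) * coeff (lie_poly \<kappa> r) (b + 1)
     + (if b = 0 then 0 else real (b - 1) / 2 * coeff (lie_poly \<kappa> r) (b - 1))"
    by (cases b; cases "b - 1") (auto simp: coeff_pderiv coeff_pCons algebra_simps)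
  finally show ?thesis .
qed

text \<open>
  The vector field lowers or raises the exponent of \<open>y\<close> by exactly one, hence the parity.
\<close>

lemma coeff_lie_poly_eq_0:
  "b > Suc r \<or> even (r + b) \<Longrightarrow> coeff (lie_poly \<kappa> r) b = 0"
proof (induction r arbitrary: b)
  case 0
  then show ?case by (auto simp: coeff_pCons split: nat.split)
next
  case (Suc r)
  have "coeff (lie_poly \<kappa> r) (b + 1) = 0" using Suc.prems by (intro Suc.IH) auto
  moreover have "b = 0 \<or> coeff (lie_poly \<kappa> r) (b - 1) = 0"
  proof (cases b)
    case (Suc b')
    show ?thesis using Suc.prems Suc by (auto intro!: Suc.IH)
  qed simp
  ultimately have "real (Suc r) * coeff (lie_poly \<kappa> (Suc r)) b = 0"
    unfolding coeff_lie_poly_Suc by auto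
  then show ?case by (simp only: mult_eq_0_iff of_nat_eq_0_iff) simp
qed

section \<open>Growth of the moments\<close>

text \<open>
  The limit of \<open>E[X^a Y^b] / (ln n)^(2a + b - 1)\<close>. Only total weight \<open>2 * a + b \<ge> 1\<close> is meaningful:
  the constant moment would have exponent \<open>-1\<close>.
\<close>

definition moment_const :: "nat \<Rightarrow> nat \<Rightarrow> nat \<Rightarrow> real" where
  "moment_const d a b =
     real d * fact a * fact b * coeff (lie_poly (1 / (real d * (real d - 1))) (2 * a + b - 1)) b"

text \<open>
  Coefficient comparison in the transport equation for \<open>lie_poly\<close>, where
  \<open>\<kappa> = 1 / (d * (d - 1))\<close> is chosen so that \<open>(d - 1) * \<kappa> = 1 / d\<close>.
\<close>

lemma moment_const_rec:
  assumes "d \<ge> 2" "2 * a + b = Suc (Suc s)"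
  shows "(real d - 1) * real (Suc s) * moment_const d a b =
    (if b \<ge> 2 then step_coeff d a b 0 2 * moment_const d a (b - 1) else 0) +
    (if a \<ge> 1 then step_coeff d a b 1 0 * moment_const d (a - 1) (b + 1) else 0)"
proof -
  define \<kappa> where "\<kappa> = 1 / (real d * (real d - 1))"
  have \<kappa>: "(real d - 1) * \<kappa> * real d = 1" using assms by (simp add: \<kappa>_def field_simps)
  have d: "real d > 1" using assms by simp
  let ?Q = "lie_poly \<kappa>"
  have "(real d - 1) * real (Suc s) * moment_const d a b = 
     (real d - 1) * real d * fact a * fact b * (real (Suc s) * coeff (?Q (Suc s)) b)"
    by (simp add: moment_const_def assms \<kappa>_def[symmetric] del: lie_poly.simps)
  also have "\<dots> = (real d - 1) * real d * fact a * fact b * (if b = 0 then 0 else real (b - 1) / 2 * coeff (?Q s) (b - 1))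
     + ((real d - 1) * \<kappa> * real d) * fact a * fact b * real (b + 1) * coeff (?Q s) (b + 1)"
    unfolding coeff_lie_poly_Suc by (simp add: algebra_simps)
  also have "(real d - 1) * real d * fact a * fact b * (if b = 0 then 0 else real (b - 1) / 2 * coeff (?Q s) (b - 1))
     = (if b \<ge> 2 then step_coeff d a b 0 2 * moment_const d a (b - 1) else 0)"
  proof (cases "b \<ge> 2")
    case True
    then obtain b' where b: "b = Suc (Suc b')" by (metis add_2_eq_Suc le_Suc_ex)
    have s: "2 * a + b' = s" using assms b by simp
    have "real (b choose 2) = real (Suc (Suc b')) * real (Suc b') / 2"
      by (simp add: b choose_two real_of_nat_div) (simp add: field_simps)
    have "moment_const d a (b - 1) = real d * fact a * fact (Suc b') * coeff (?Q s) (Suc b')"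
      by (simp add: moment_const_def \<kappa>_def b flip: s)
    moreover have "(fact b :: real) = real (Suc (Suc b')) * fact (Suc b')"
      unfolding b by (rule fact_Suc)
    ultimately show ?thesis
      using \<open>real (b choose 2) = _\<close> True by (simp add: step_coeff_simps[OF assms(1)] b del: fact_Suc)
  next
    case False
    then show ?thesis by (cases b; cases "b - 1") auto
  qed
  also have "((real d - 1) * \<kappa> * real d) * fact a * fact b * real (b + 1) * coeff (?Q s) (b + 1)
     = (if a \<ge> 1 then step_coeff d a b 1 0 * moment_const d (a - 1) (b + 1) else 0)"
  proof (cases a)
    case 0
    then have "coeff (?Q s) (b + 1) = 0" using assms by (intro coeff_lie_poly_eq_0) auto
    then show ?thesis using 0 by simp
  next
    case (Suc a')
    have s: "2 * a' + b = s" using assms Suc by simp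
    have "moment_const d (a - 1) (b + 1) = real d * fact a' * (real (b + 1) * fact b) * coeff (?Q s) (b + 1)"
      by (simp add: moment_const_def \<kappa>_def Suc flip: s)
    moreover have "(fact a :: real) = real a * fact a'"
      unfolding Suc by (rule fact_Suc)
    ultimately show ?thesis
      using d Suc by (simp add: \<kappa> step_coeff_simps[OF assms(1)] del: fact_Suc of_nat_Suc)
  qed
  finally show ?thesis .
qed

text \<open>
  Induction on the weight \<open>2 * a + b\<close>. The moment with exponents \<open>a - i\<close> and \<open>b - j + 1\<close> has weight
  smaller by \<open>2 * i + j - 1\<close>. The two terms for which this is not positive vanish, those with
  \<open>2 * i + j = 2\<close> give the limit, and all others are smaller by a power of the logarithm. The base
  case \<open>E[Y] = d\<close> is the martingale property. The constant moment, which the induction does not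
  cover, never arises, because the exponent \<open>b - j + 1\<close> is positive.
\<close>

lemma moment_asymptotics:
  fixes m :: "nat \<Rightarrow> nat \<Rightarrow> nat \<Rightarrow> real"
  assumes d: "d \<ge> 2"
    and init: "m 0 1 1 = real d"
    and step: "\<And>a b n. n \<ge> 1 \<Longrightarrow> m a b (Suc n) - m a b n =
       (\<Sum>i\<le>a. \<Sum>j\<le>b. step_coeff d a b i j * m (a - i) (b - j + 1) n) / ((real d - 1) * real n + 1)"
    and "2 * a + b \<ge> 1"
  shows "(\<lambda>n. m a b n / ln (real n) ^ (2 * a + b - 1)) \<longlonglongrightarrow> moment_const d a b"
  using \<open>2 * a + b \<ge> 1\<close>
proof (induction "2 * a + b" arbitrary: a b rule: less_induct)
  case less
  show ?case
  proof (cases "2 * a + b = 1")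
    case True
    then have ab: "a = 0" "b = 1" by presburger+
    have "m 0 1 n = real d" if "n \<ge> 1" for n
      using that
    proof (induction n rule: dec_induct)
      case (step n)
      then show ?case using assms(3)[of n 0 1] by (simp add: step_coeff_simps[OF d])
    qed (use init in simp)
    then have "eventually (\<lambda>n. m a b n / ln (real n) ^ (2 * a + b - 1) = moment_const d a b) sequentially"
      by (intro eventually_mono[OF eventually_ge_at_top[of 1]]) (simp add: ab moment_const_def)
    then show ?thesis by (rule tendsto_eventually)
  next
    case False
    with less.prems obtain s where s: "2 * a + b = Suc (Suc s)"
      by (metis One_nat_def Suc_le_D Suc_le_mono le0 nat.exhaust)
    define A B where "A = (if b \<ge> 2 then step_coeff d a b 0 2 * moment_const d a (b - 1) else 0)"
      and "B = (if a \<ge> 1 then step_coeff d a b 1 0 * moment_const d (a - 1) (b + 1) else 0)"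
    let ?lim = "\<lambda>i j. (if i = 0 then if j = 2 then A else 0 else 0) + (if i = 1 then if j = 0 then B else 0 else 0)"
    have term_lim: "(\<lambda>n. step_coeff d a b i j * m (a - i) (b - j + 1) n / ln (real n) ^ s) \<longlonglongrightarrow> ?lim i j"
      if ij: "i \<le> a" "j \<le> b" for i j
    proof (cases "2 * i + j \<ge> 2")
      case False
      then have "i = 0" "j = 0 \<or> j = 1" by auto
      then show ?thesis by (auto simp: step_coeff_simps[OF d])
    next
      case True
      (* e counts the missing factors of the logarithm; the term survives in the limit iff e = 0. *)
      define e where "e = 2 * i + j - 2"
      have ord: "2 * (a - i) + (b - j + 1) - 1 + e = s" using ij True s by (simp add: e_def)
      have IH: "(\<lambda>n. m (a - i) (b - j + 1) n / ln (real n) ^ (2 * (a - i) + (b - j + 1) - 1))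
          \<longlonglongrightarrow> moment_const d (a - i) (b - j + 1)"
        using ij True s by (intro less.hyps) auto
      have "(\<lambda>n. inverse (ln (real n)) ^ e) \<longlonglongrightarrow> 0 ^ e"
        by (intro tendsto_power) real_asymp
      with IH have "(\<lambda>n. step_coeff d a b i j * (m (a - i) (b - j + 1) n / ln (real n) ^ (2 * (a - i) + (b - j + 1) - 1) *
         inverse (ln (real n)) ^ e))
         \<longlonglongrightarrow> step_coeff d a b i j * (moment_const d (a - i) (b - j + 1) * 0 ^ e)"
        by (intro tendsto_mult tendsto_const)
      moreover have "step_coeff d a b i j * (moment_const d (a - i) (b - j + 1) * 0 ^ e) = ?lim i j"
      proof (cases "e = 0")
        case True
        with \<open>2 * i + j \<ge> 2\<close> have "i = 0 \<and> j = 2 \<or> i = 1 \<and> j = 0"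
          unfolding e_def by presburger
        then show ?thesis
        proof
          assume 02: "i = 0 \<and> j = 2"
          then have "b - j + 1 = b - 1" using ij by simp
          then show ?thesis unfolding A_def using 02 ij True by simp
        next
          assume "i = 1 \<and> j = 0"
          then show ?thesis unfolding B_def using ij True by simp
        qed
      next
        case False
        then show ?thesis by (auto simp: e_def)
      qed
      ultimately show ?thesis
        by (simp add: ord[symmetric] power_add power_inverse divide_inverse mult.assoc)
    qed
    have "(\<lambda>n. \<Sum>i\<le>a. \<Sum>j\<le>b. step_coeff d a b i j * m (a - i) (b - j + 1) n / ln (real n) ^ s)
       \<longlonglongrightarrow> (\<Sum>i\<le>a. \<Sum>j\<le>b. ?lim i j)"
      by (intro tendsto_sum term_lim) auto
    also have "(\<Sum>i\<le>a. \<Sum>j\<le>b. ?lim i j) = A + B"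
    proof -
      have "(\<Sum>i\<le>a. \<Sum>j\<le>b. ?lim i j) = 
        (\<Sum>i\<le>a. (if i = 0 then \<Sum>j\<le>b. if j = 2 then A else 0 else 0) + (if i = 1 then \<Sum>j\<le>b. if j = 0 then B else 0 else 0))"
        by (intro sum.cong) (auto simp: sum.distrib)
      also have "\<dots> = (if 2 \<le> b then A else 0) + (if 1 \<le> a then B else 0)"
        by (simp add: sum.distrib sum.delta)
      finally show ?thesis by (simp add: A_def B_def)
    qed
    finally have "(\<lambda>n. (\<Sum>i\<le>a. \<Sum>j\<le>b. step_coeff d a b i j * m (a - i) (b - j + 1) n) / ln (real n) ^ s)
       \<longlonglongrightarrow> (real d - 1) * real (Suc s) * moment_const d a b"
      unfolding moment_const_rec[OF d s] A_def B_def by (simp add: sum_divide_distrib)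
    then have "(\<lambda>n. m a b n / ln (real n) ^ Suc s) \<longlonglongrightarrow>
        (real d - 1) * real (Suc s) * moment_const d a b / ((real d - 1) * real (Suc s))"
      using d step by (intro ln_power_asymptotics_of_increments) auto
    then show ?thesis using d by (simp add: s)
  qed
qed

lemma moment_const_1: "d \<ge> 2 \<Longrightarrow> moment_const d 1 0 = 1 / (real d - 1)"
  by (simp add: moment_const_def pderiv_pCons)

text \<open>
  The Riccati equation at \<open>y = 0\<close> and order \<open>t^(2k - 2)\<close>. By parity only odd orders \<open>2 * j - 1\<close>
  and \<open>2 * (k - j) - 1\<close> contribute to the square, and the factorials in the normalisation turn its
  convolution into a binomial one.
\<close>

lemma moment_const_convolution:
  assumes d: "d \<ge> 2" and k: "k \<ge> 2"
  shows "(2 * real k - 1) * moment_const d k 0 =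
     1 / (2 * real d) * (\<Sum>j=1..k-1. real (k choose j) * moment_const d j 0 * moment_const d (k - j) 0)"
proof -
  define q where "q r = coeff (lie_poly (1 / (real d * (real d - 1))) r) 0" for r
  have c: "moment_const d j 0 = real d * fact j * q (2 * j - 1)" for j
    by (simp add: moment_const_def q_def)
  have q_even: "q r = 0" if "even r" for r
    using that unfolding q_def by (intro coeff_lie_poly_eq_0) auto
  have sr: "Suc (2 * k - 2) = 2 * k - 1" using k by simp
  have "(2 * real k - 1) * q (2 * k - 1) = real (Suc (2 * k - 2)) * q (Suc (2 * k - 2))"
    using k unfolding sr by (simp add: of_nat_diff)
  also have "\<dots> = 1/2 * (\<Sum>i\<le>2 * k - 2. q i * q (2 * k - 2 - i))"
    using arg_cong[OF lie_poly_riccati[of "2 * k - 2"], of "\<lambda>p. coeff p 0"] k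
    by (simp add: q_def coeff_sum coeff_mult_0 del: lie_poly.simps)
  also have "(\<Sum>i\<le>2 * k - 2. q i * q (2 * k - 2 - i)) = (\<Sum>j=1..k-1. q (2 * j - 1) * q (2 * (k - j) - 1))"
  proof -
    have "(\<Sum>j=1..k-1. q (2 * j - 1) * q (2 * (k - j) - 1)) = 
      (\<Sum>i\<in>(\<lambda>j. 2 * j - 1) ` {1..k-1}. q i * q (2 * k - 2 - i))"
      by (subst sum.reindex) (auto simp: inj_on_def intro!: sum.cong arg_cong[where f = q])
    also have "\<dots> = (\<Sum>i\<le>2 * k - 2. q i * q (2 * k - 2 - i))"
    proof (intro sum.mono_neutral_left ballI)
      fix i assume i: "i \<in> {..2 * k - 2} - (\<lambda>j. 2 * j - 1) ` {1..k-1}"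
      have "even i"
      proof (rule ccontr)
        assume "odd i"
        then obtain l where "i = 2 * l + 1" by (elim oddE)
        then have "i = 2 * Suc l - 1" "Suc l \<in> {1..k-1}" using i by auto
        then show False using i by blast
      qed
      then show "q i * q (2 * k - 2 - i) = 0" by (simp add: q_even)
    qed (auto simp: k)
    finally show ?thesis ..
  qed
  finally have eq: "(2 * real k - 1) * q (2 * k - 1) = 1/2 * (\<Sum>j=1..k-1. q (2 * j - 1) * q (2 * (k - j) - 1))" .
  have "(2 * real k - 1) * moment_const d k 0 = real d * fact k * ((2 * real k - 1) * q (2 * k - 1))"
    by (simp add: c)
  also have "\<dots> = 1 / (2 * real d) * (\<Sum>j=1..k-1. real d ^ 2 * fact k * (q (2 * j - 1) * q (2 * (k - j) - 1)))"
    unfolding eq using d by (simp add: sum_distrib_left[symmetric] field_simps power2_eq_square)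
  also have "(\<Sum>j=1..k-1. real d ^ 2 * fact k * (q (2 * j - 1) * q (2 * (k - j) - 1)))
    = (\<Sum>j=1..k-1. real (k choose j) * moment_const d j 0 * moment_const d (k - j) 0)"
  proof (intro sum.cong refl)
    fix j assume "j \<in> {1..k-1}"
    then have "fact j * fact (k - j) * (k choose j) = fact k" by (intro binomial_fact_lemma) auto
    then have "(fact k :: real) = real (fact j * fact (k - j) * (k choose j))" by simp
    then have "(fact k :: real) = fact j * fact (k - j) * real (k choose j)" by simp
    then show "real d ^ 2 * fact k * (q (2 * j - 1) * q (2 * (k - j) - 1))
      = real (k choose j) * moment_const d j 0 * moment_const d (k - j) 0"
      by (simp add: c power2_eq_square)
  qed
  finally show ?thesis .
qed

section \<open>Moments of the root cluster\<close>

theorem theorem2p14: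
  fixes d :: nat and p :: real and E :: "nat \<Rightarrow> real"
  assumes "d \<ge> 2"
    and "p = 1 / real d"
    and "E 1 = 1 / (real d - 1)"
    and "\<And>k. k \<ge> 2 \<Longrightarrow> (2 * real k - 1) * E k =
           1 / (2 * real d) * (\<Sum>j=1..k-1. real (k choose j) * E j * E (k - j))"
  shows "\<forall>k\<ge>1. (\<lambda>n. measure_pmf.expectation (coloured_tree d p n)
                   (\<lambda>t. real (card (root_cluster t)) ^ k))
           \<sim>[at_top] (\<lambda>n. E k * ln (real n) ^ (2 * k - 1))"
proof (intro allI impI)
  fix k :: nat assume k: "k \<ge> 1"
  (* Positivity is what makes the limit of the normalised moment an asymptotic equivalence. *)
  have E: "moment_const d k 0 = E k \<and> E k > 0" if "k \<ge> 1" for k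
    using that
  proof (induction k rule: less_induct)
    case (less k)
    show ?case
    proof (cases "k = 1")
      case True
      then show ?thesis using assms(1,3) moment_const_1[OF assms(1)] by simp
    next
      case False
      with less.prems have k: "k \<ge> 2" by simp
      have IH: "moment_const d j 0 = E j" "E j > 0" if "j \<in> {1..k-1}" for j
        using that less.IH[of j] by auto
      have IH': "moment_const d (k - j) 0 = E (k - j)" "E (k - j) > 0" if "j \<in> {1..k-1}" for j
      proof -
        have "k - j \<in> {1..k-1}" using that k unfolding atLeastAtMost_iff by arith
        then show "moment_const d (k - j) 0 = E (k - j)" "E (k - j) > 0" by (rule IH)+
      qed
      have "(\<Sum>j=1..k-1. real (k choose j) * E j * E (k - j)) > 0"
        using k by (intro sum_pos mult_pos_pos IH IH') auto
      then have pos: "(2 * real k - 1) * E k > 0"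
        unfolding assms(4)[OF k] using assms(1) by (intro mult_pos_pos) auto
      have "(2 * real k - 1) * moment_const d k 0 = (2 * real k - 1) * E k"
        unfolding moment_const_convolution[OF assms(1) k] assms(4)[OF k]
        by (intro arg_cong2[where f = "(*)"] sum.cong refl) (simp_all only: IH IH')
      with pos show ?thesis using k by (simp add: zero_less_mult_iff)
    qed
  qed
  have "(\<lambda>n. cluster_moment d p k 0 n / ln (real n) ^ (2 * k + 0 - 1)) \<longlonglongrightarrow> moment_const d k 0"
    using assms(1) k unfolding assms(2)
    by (intro moment_asymptotics cluster_moment_Suc) (use cluster_moment_1 in auto)
  then have "(\<lambda>n. cluster_moment d p k 0 n / ln (real n) ^ (2 * k - 1) / E k) \<longlonglongrightarrow> E k / E k"
    using E[OF k] by (intro tendsto_divide) auto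
  then have "(\<lambda>n. cluster_moment d p k 0 n / (E k * ln (real n) ^ (2 * k - 1))) \<longlonglongrightarrow> 1"
    using E[OF k] by (simp add: mult.commute)
  then have "cluster_moment d p k 0 \<sim>[at_top] (\<lambda>n. E k * ln (real n) ^ (2 * k - 1))"
    by (rule asymp_equivI')
  then show "(\<lambda>n. measure_pmf.expectation (coloured_tree d p n) (\<lambda>t. real (card (root_cluster t)) ^ k))
           \<sim>[at_top] (\<lambda>n. E k * ln (real n) ^ (2 * k - 1))"
    by (simp add: cluster_moment_def[abs_def])
qed

end
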